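(* For all integers $r\geq2$ and $n\geq1$, the $h^\ast$-polynomial $h^\ast(\mathcal{B}_{(r,n)};z)$ of the base-$r$ $n$-simplex $\mathcal{B}_{(r,n)}$ is real-rooted, and thus unimodal.
   Context: For integers $r\geq2$, $n\geq1$, the base-$r$ $n$-simplex is $\mathcal{B}_{(r,n)}:=\mathrm{conv}(e_1,\ldots,e_n,-q)\subset\mathbb{R}^n$, where $e_1,\ldots,e_n$ are the standard basis vectors and $q=((r-1),(r-1)r,(r-1)r^2,\ldots,(r-1)r^{n-1})$. For a $d$-dimensional lattice polytope $P\subset\mathbb{R}^n$, the $h^\ast$-polynomial $h^\ast(P;z)=h_0^\ast+h_1^\ast z+\cdots+h_d^\ast z^d$ is defined by $\sum_{t\geq0}|tP\cap\mathbb{Z}^n|z^t=\frac{h^\ast(P;z)}{(1-z)^{d+1}}$. A polynomial $a_0+a_1z+\cdots+a_dz^d$ with nonnegative integer coefficients is real-rooted if all of its roots are real numbers, and unimodal if there is an index $j$ with $a_i\leq a_{i+1}$ for all $i<j$ and $a_i\geq a_{i+1}$ for all $i\geq j$. *)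

theory Defs
  imports "HOL-Analysis.Analysis" "HOL-Computational_Algebra.Computational_Algebra"
begin

definition lattice_points :: "(real ^ 'n) set" where
  "lattice_points = {x. \<forall>i. x $ i \<in> \<int>}"

definition lattice_count :: "(real ^ 'n) set \<Rightarrow> nat \<Rightarrow> nat" where
  "lattice_count P t = card ((\<lambda>x. real t *\<^sub>R x) ` P \<inter> lattice_points)"

definition ehrhart_series :: "(real ^ 'n) set \<Rightarrow> int fps" where
  "ehrhart_series P = Abs_fps (\<lambda>t. int (lattice_count P t))"

text \<open>The identity \<open>ehrhart_series P = h / (1 - z) ^ (d + 1)\<close> with denominators cleared. The
  function is total, but a suitable \<open>h\<close> exists (and the value is meaningful) only for suitable
  \<open>P\<close>, in particular for lattice polytopes.\<close>

definition h_star :: "(real ^ 'n) set \<Rightarrow> int poly" where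
  "h_star P = (THE h. degree h \<le> nat (aff_dim P) \<and>
     ehrhart_series P * (1 - fps_X) ^ (nat (aff_dim P) + 1) = fps_of_poly h)"

lemma h_star_eqI:
  assumes "degree h \<le> nat (aff_dim P)"
    and "ehrhart_series P * (1 - fps_X) ^ (nat (aff_dim P) + 1) = fps_of_poly h"
  shows "h_star P = h"
  unfolding h_star_def using assms by (intro the_equality) auto

text \<open>The coordinates of \<open>real ^ 'n\<close> are ordered by the linear order on \<open>'n\<close>, so that
  \<open>card {j. j < i}\<close> is the zero-based position of coordinate \<open>i\<close>; thus
  \<open>base_q r = (r - 1, (r - 1) r, \<dots>, (r - 1) r ^ (n - 1))\<close> with \<open>n = CARD('n)\<close>.\<close>

definition base_q :: "nat \<Rightarrow> real ^ ('n :: {finite, linorder})" where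
  "base_q r = (\<chi> i. (real r - 1) * real r ^ card {j. j < i})"

definition base_simplex :: "nat \<Rightarrow> (real ^ ('n :: {finite, linorder})) set" where
  "base_simplex r = convex hull (insert (- base_q r) (range (\<lambda>i. axis i 1)))"

text \<open>All roots are taken in the complex numbers.\<close>

definition real_rooted :: "int poly \<Rightarrow> bool" where
  "real_rooted p \<longleftrightarrow> (\<forall>z :: complex. poly (map_poly of_int p) z = 0 \<longrightarrow> z \<in> \<real>)"

text \<open>Coefficients beyond the degree are zero, so for polynomials with nonnegative coefficients
  leaving \<open>i\<close> unbounded agrees with restricting the indices to any range \<open>0, \<dots>, d\<close> with
  \<open>d \<ge> degree p\<close>.\<close>

definition unimodal :: "int poly \<Rightarrow> bool" where
  "unimodal p \<longleftrightarrow> (\<exists>j. (\<forall>i<j. coeff p i \<le> coeff p (i + 1)) \<and>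
                        (\<forall>i\<ge>j. coeff p i \<ge> coeff p (i + 1)))"

end

theory Submission
  imports Defs
begin

text \<open>Write \<open>m = r - 1\<close> and \<open>N = r ^ n\<close>. Lattice points of the \<open>t\<close>-th dilate of a simplex
  \<open>conv(e\<^sub>1, \<dots>, e\<^sub>n, -q)\<close> with \<open>1 + \<Sum>q\<^sub>i = N\<close> correspond to pairs of some \<open>b < N\<close> and \<open>n + 1\<close> natural
  numbers of sum \<open>t - age(b)\<close>, which gives \<open>h* = \<Sum>b<N. z ^ age(b)\<close> with
  \<open>age(b) = b - \<Sum>i. \<lfloor>q\<^sub>i b / N\<rfloor>\<close>. For the base-\<open>r\<close> weights, Legendre's formula turns \<open>age(b)\<close> into
  \<open>\<lceil>s(c) / m\<rceil>\<close>, where \<open>s\<close> is the base-\<open>r\<close> digit sum and \<open>c = m b mod N\<close>. Hence the coefficient of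
  \<open>z ^ j\<close> in \<open>h*\<close> is the coefficient of \<open>x ^ (m j)\<close> in
  \<open>F(x) = (1 + x + \<dots> + x ^ m) ^ n (1 + x + \<dots> + x ^ (m - 1))\<close>. Unimodality is inherited from \<open>F\<close>,
  whose coefficients are symmetric and decrease away from the centre.

  For real-rootedness, fix \<open>z\<close> in the open upper half-plane. The sections \<open>G k\<close> of
  \<open>x ^ k (1 + x + \<dots> + x ^ m) ^ n\<close> with step \<open>m\<close>, evaluated at \<open>z\<close>, satisfy \<open>G (k + m) = z G k\<close>, and
  passing from \<open>n\<close> to \<open>n + 1\<close> replaces \<open>G k\<close> by \<open>G k + \<dots> + G (k + m)\<close>. This preserves the
  property that the arguments of \<open>G k, \<dots>, G (k + m)\<close> are in increasing order, which is the
  analogue of interlacing. In particular \<open>h*(z) = G 0 + \<dots> + G (m - 1)\<close> is a sum of vectors in a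
  convex cone containing no line, and \<open>G 0 \<noteq> 0\<close>, so it does not vanish.\<close>

subsection \<open>Sums over windows of vectors with increasing argument\<close>

text \<open>The cross product of plane vectors; \<open>wedge u v \<ge> 0\<close> encodes that
  \<open>v\<close> lies within a half turn counterclockwise of \<open>u\<close>.\<close>

definition wedge :: "complex \<Rightarrow> complex \<Rightarrow> real" where
  "wedge u v = Im (cnj u * v)"

lemma wedge_self: "wedge u u = 0"
  by (simp add: wedge_def)

lemma wedge_mult_self: "wedge u (z * u) = Im z * (cmod u)\<^sup>2"
  unfolding wedge_def cmod_power2 by (simp add: power2_eq_square algebra_simps)

lemma wedge_sum_left: "wedge (sum f A) v = (\<Sum>i\<in>A. wedge (f i) v)"
  by (simp add: wedge_def sum_distrib_right)

lemma wedge_sum_right: "wedge u (sum f A) = (\<Sum>i\<in>A. wedge u (f i))"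
  by (simp add: wedge_def sum_distrib_left)

lemma wedge_mult_right: "wedge u (z * v) = Re z * wedge u v + Im z * inner u v"
  by (simp add: wedge_def inner_complex_def algebra_simps)

text \<open>If \<open>wedge a b > 0\<close>, then \<open>g\<close> lies in the cone spanned by
  \<open>a\<close> and \<open>b\<close>, whose angle is acute. Otherwise \<open>b\<close> is a
  positive and \<open>g\<close> a real multiple of \<open>a\<close>, and the condition on
  \<open>z * a\<close> excludes negative multiples.\<close>

lemma inner_between_nonneg:
  assumes z: "Im z > 0" and ab: "wedge a b \<ge> 0" "inner a b > 0"
    and g: "wedge a g \<ge> 0" "wedge g b \<ge> 0" "wedge g (z * a) \<ge> 0"
  shows "inner g (a + b) \<ge> 0"
proof -
  have pos: "inner a (a + b) > 0" "inner b (a + b) > 0"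
    using ab(2) by (simp_all add: inner_add_right inner_commute add_nonneg_pos add_pos_nonneg)
  \<comment> \<open>Cramer's rule \<open>wedge a b *\<^sub>R g = wedge g b *\<^sub>R a + wedge a g
    *\<^sub>R b\<close>, paired with \<open>a + b\<close>.\<close>
  have expand: "wedge a b * inner g (a + b) = wedge g b * inner a (a + b) + wedge a g * inner b (a + b)"
    by (simp add: wedge_def inner_complex_def algebra_simps)
  show ?thesis
  proof (cases "wedge a b = 0")
    case False
    with ab have "wedge a b > 0" by simp
    moreover have "wedge a b * inner g (a + b) \<ge> 0"
      unfolding expand using g pos by simp
    ultimately show ?thesis by (simp add: zero_le_mult_iff)
  next
    case True
    have "wedge g b * inner a (a + b) \<ge> 0" "wedge a g * inner b (a + b) \<ge> 0"
      using g pos by simp_all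
    moreover have "wedge g b * inner a (a + b) + wedge a g * inner b (a + b) = 0"
      unfolding expand[symmetric] by (simp add: True)
    ultimately have "wedge a g * inner b (a + b) = 0" by linarith
    with pos have ag: "wedge a g = 0" by simp
    then have "wedge g a = 0" by (simp add: wedge_def algebra_simps)
    with g(3) z have ga: "inner g a \<ge> 0"
      by (simp add: wedge_mult_right zero_le_mult_iff)
    have "inner a a * inner g b = inner g a * inner a b + wedge a g * wedge a b"
      by (simp add: wedge_def inner_complex_def algebra_simps)
    with ag ga ab have "inner a a * inner g b \<ge> 0" by simp
    moreover have "inner a a > 0" using ab(2) by auto
    ultimately have "inner g b \<ge> 0" by (simp add: zero_le_mult_iff)
    with ga show ?thesis by (simp add: inner_add_right)
  qed
qed

text \<open>The induction step for the ordering of arguments. The wedge of the two windows expands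
  bilinearly into nonnegative terms, except for \<open>- Im z * inner a b\<close>, which
  \<open>Im z\<close> times the square of \<open>T + a + b\<close> absorbs.\<close>

lemma wedge_window_sum_nonneg:
  fixes G :: "nat \<Rightarrow> complex"
  assumes z: "Im z > 0"
    and per: "\<And>k. G (k + m) = z * G k"
    and win: "\<And>k j. j \<le> m \<Longrightarrow> wedge (G k) (G (k + j)) \<ge> 0"
    and "j \<le> m"
  shows "wedge (\<Sum>i\<le>m. G (k + i)) (\<Sum>i\<le>m. G (k + j + i)) \<ge> 0"
proof -
  consider "j = 0" | "j = m" | "0 < j" "j < m" using \<open>j \<le> m\<close> by linarith
  then show ?thesis
  proof cases
    case 1
    then show ?thesis by (simp add: wedge_self)
  next
    case 2
    have "(\<Sum>i\<le>m. G (k + j + i)) = z * (\<Sum>i\<le>m. G (k + i))"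
      unfolding sum_distrib_left per[symmetric] 2 by (intro sum.cong refl arg_cong[of _ _ G]) simp
    then show ?thesis using z by (simp add: wedge_mult_self)
  next
    case 3
    define a b where "a = G k" and "b = G (k + j)"
    \<comment> \<open>The windows share \<open>b\<close>, \<open>R\<close>, \<open>z * a\<close>;
      the first starts with \<open>a\<close>, \<open>T\<close>, and the second ends with
      \<open>z * T\<close>, \<open>z * b\<close>.\<close>
    define T R where "T = (\<Sum>i\<in>{0<..<j}. G (k + i))" and "R = (\<Sum>i\<in>{j<..<m}. G (k + i))"
    have win': "wedge (G p) (G s) \<ge> 0" if "p \<le> s" "s \<le> p + m" for p s
      using win[of "s - p" p] that by simp
    have za: "G (k + m) = z * a" by (simp add: per a_def)
    have zb: "G (k + j + m) = z * b" by (simp add: per b_def)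
    have zG: "z * G (k + i) = G (k + m + i)" for i
      using per[of "k + i"] by (simp add: ac_simps)
    have zT: "z * T = (\<Sum>i\<in>{0<..<j}. G (k + m + i))"
      by (simp add: T_def sum_distrib_left zG)
    have S1: "(\<Sum>i\<le>m. G (k + i)) = a + T + b + R + z * a"
    proof -
      have "{..m} = insert 0 (insert j (insert m ({0<..<j} \<union> {j<..<m})))" using 3 by auto
      moreover have "(\<Sum>i\<in>{0<..<j} \<union> {j<..<m}. G (k + i)) = T + R"
        unfolding T_def R_def by (intro sum.union_disjoint) auto
      ultimately show ?thesis using 3 by (simp add: za flip: a_def b_def)
    qed
    have S2: "(\<Sum>i\<le>m. G (k + j + i)) = b + R + z * a + z * T + z * b"
    proof -
      have "(\<Sum>i\<le>m. G (k + j + i)) = (\<Sum>i\<in>{j..m + j}. G (k + i))"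
        by (rule sum.reindex_bij_witness[of _ "\<lambda>i. i - j" "\<lambda>i. i + j"]) (auto simp: ac_simps)
      also have "{j..m + j} = insert j (insert m (insert (j + m) ({j<..<m} \<union> {m<..<m + j})))"
        using 3 by auto
      also have "(\<Sum>i\<in>\<dots>. G (k + i)) = b + (z * a + (z * b + (\<Sum>i\<in>{j<..<m} \<union> {m<..<m + j}. G (k + i))))"
        using 3 by (simp add: za flip: a_def b_def zb add.assoc)
      also have "(\<Sum>i\<in>{j<..<m} \<union> {m<..<m + j}. G (k + i)) = R + (\<Sum>i\<in>{m<..<m + j}. G (k + i))"
        unfolding R_def by (intro sum.union_disjoint) auto
      also have "(\<Sum>i\<in>{m<..<m + j}. G (k + i)) = z * T"
        unfolding zT
        by (rule sum.reindex_bij_witness[of _ "\<lambda>i. i + m" "\<lambda>i. i - m"]) (auto simp: ac_simps)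
      finally show ?thesis by simp
    qed
    have ab: "wedge a b \<ge> 0" using 3 by (auto simp: a_def b_def intro!: win')
    have aR: "wedge a R \<ge> 0" using 3 by (auto simp: a_def R_def wedge_sum_right intro!: sum_nonneg win')
    have aT: "wedge a T \<ge> 0" using 3 by (auto simp: a_def T_def wedge_sum_right intro!: sum_nonneg win')
    have Tb: "wedge T b \<ge> 0" using 3 by (auto simp: b_def T_def wedge_sum_left intro!: sum_nonneg win')
    have TR: "wedge T R \<ge> 0"
      using 3 by (auto simp: T_def R_def wedge_sum_left wedge_sum_right intro!: sum_nonneg win')
    have RT: "wedge R (z * T) \<ge> 0"
      unfolding zT using 3 by (auto simp: R_def wedge_sum_left wedge_sum_right intro!: sum_nonneg win')
    have Rb: "wedge R (z * b) \<ge> 0"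
      unfolding zb[symmetric] using 3 by (auto simp: R_def wedge_sum_left intro!: sum_nonneg win')
    \<comment> \<open>If \<open>inner a b > 0\<close>, every summand of \<open>T\<close> lies
      between \<open>a\<close> and \<open>b\<close>, so \<open>inner T (a + b) \<ge> 0\<close> and
      the expanded square dominates \<open>inner a b\<close>.\<close>
    have sq: "(cmod (T + a + b))\<^sup>2 - inner a b \<ge> 0"
    proof (cases "inner a b > 0")
      case True
      have "inner (G (k + i)) (a + b) \<ge> 0" if "i \<in> {0<..<j}" for i
        using that 3 unfolding za[symmetric]
        by (intro inner_between_nonneg[OF z ab True]) (auto simp: a_def b_def za[symmetric, unfolded a_def] intro!: win')
      then have "inner T (a + b) \<ge> 0"
        unfolding T_def inner_sum_left by (intro sum_nonneg) auto
      moreover have "(cmod (T + a + b))\<^sup>2 - inner a b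
          = inner T T + 2 * inner T (a + b) + inner a a + inner b b + inner a b"
        by (simp add: power2_norm_eq_inner inner_add_left inner_add_right inner_commute)
      ultimately show ?thesis using True by (simp add: add_nonneg_nonneg)
    next
      case False
      then show ?thesis using zero_le_power2[of "cmod (T + a + b)"] by linarith
    qed
    have "1 + Re z + (cmod z)\<^sup>2 = (Re z + 1/2)\<^sup>2 + 3/4 + (Im z)\<^sup>2"
      unfolding cmod_power2 by (simp add: power2_eq_square field_simps)
    then have "1 + Re z + (cmod z)\<^sup>2 \<ge> 0"
      by (simp add: add_nonneg_nonneg)
    moreover have "wedge (a + T + b + R + z * a) (b + R + z * a + z * T + z * b)
        = (1 + Re z + (cmod z)\<^sup>2) * wedge a b + Im z * ((cmod (T + a + b))\<^sup>2 - inner a b)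
          + wedge T b + (cmod z)\<^sup>2 * wedge a T + wedge a R + wedge T R + wedge R (z * T) + wedge R (z * b)"
      unfolding cmod_power2 by (simp add: wedge_def inner_complex_def power2_eq_square algebra_simps)
    ultimately show ?thesis
      unfolding S1 S2 using z ab aR aT Tb TR RT Rb sq by (simp add: add_nonneg_nonneg)
  qed
qed

text \<open>The real-linear functional \<open>L\<close> is nonnegative on
  \<open>G 0, ..., G m\<close>, which lie between \<open>G 0\<close> and \<open>z * G 0\<close>, and
  positive at \<open>G 0\<close>; it separates the sum from 0.\<close>

lemma window_sum_nonzero:
  fixes G :: "nat \<Rightarrow> complex"
  assumes z: "Im z > 0" and per: "G m = z * G 0"
    and win: "\<And>k j. j \<le> m \<Longrightarrow> wedge (G k) (G (k + j)) \<ge> 0"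
    and "G 0 \<noteq> 0" "0 < l" "l \<le> Suc m"
  shows "(\<Sum>i<l. G i) \<noteq> 0"
proof
  assume eq0: "(\<Sum>i<l. G i) = 0"
  define L where "L v = wedge (G 0) v + wedge v (z * G 0)" for v
  have "L (G i) \<ge> 0" if "i < l" for i
    using win[of i 0] win[of "m - i" i] that assms(6) unfolding L_def per[symmetric] by simp
  then have "(\<Sum>i\<in>{0}. L (G i)) \<le> (\<Sum>i<l. L (G i))"
    using \<open>0 < l\<close> by (intro sum_mono2) auto
  also have "\<dots> = L (\<Sum>i<l. G i)"
    by (simp add: L_def sum.distrib wedge_sum_left wedge_sum_right)
  also have "\<dots> = 0" by (simp add: eq0 L_def wedge_def)
  finally have "Im z * (cmod (G 0))\<^sup>2 \<le> 0" by (simp add: L_def wedge_mult_self wedge_self)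
  with z \<open>G 0 \<noteq> 0\<close> show False by (simp add: mult_le_0_iff)
qed

subsection \<open>Digit sums\<close>

text \<open>The ceiling of \<open>s / m\<close> for \<open>m > 0\<close>.\<close>

definition cdiv :: "nat \<Rightarrow> nat \<Rightarrow> nat" where
  "cdiv s m = (s + m - 1) div m"

lemma le_mult_cdiv:
  assumes "m > 0"
  shows "s \<le> m * cdiv s m" "m * cdiv s m - s < m"
proof -
  have "m * cdiv s m + (s + m - 1) mod m = s + m - 1"
    unfolding cdiv_def by simp
  moreover have "(s + m - 1) mod m < m" using assms by simp
  ultimately show "s \<le> m * cdiv s m" "m * cdiv s m - s < m" by linarith+
qed

text \<open>Exactly one of the \<open>m\<close> consecutive numbers \<open>s, ..., s + m - 1\<close>
  is a multiple of \<open>m\<close>.\<close>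

lemma add_eq_mult_iff_cdiv:
  assumes "k < m"
  shows "s + k = m * j \<longleftrightarrow> j = cdiv s m \<and> k = m * cdiv s m - s"
proof
  assume eq: "s + k = m * j"
  then have "s + m - 1 = (m - 1 - k) + m * j" using assms by simp
  then have "cdiv s m = j + (m - 1 - k) div m"
    unfolding cdiv_def using assms by (simp only: div_mult_self2)
  then have "cdiv s m = j" using assms by simp
  with eq show "j = cdiv s m \<and> k = m * cdiv s m - s" by auto
next
  assume "j = cdiv s m \<and> k = m * cdiv s m - s"
  with le_mult_cdiv(1)[of m s] assms show "s + k = m * j" by auto
qed

fun digit_sum :: "nat \<Rightarrow> nat \<Rightarrow> nat \<Rightarrow> nat" where
  "digit_sum r 0 c = 0"
| "digit_sum r (Suc n) c = c mod r + digit_sum r n (c div r)"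

text \<open>Legendre's formula. With \<open>d = c div r\<close>, the term \<open>k = 1\<close> is
  \<open>d\<close> and the later terms are those of \<open>d\<close>, so the induction hypothesis
  leaves \<open>(r - 1) * d + d + c mod r = c\<close>.\<close>

lemma legendre_digit_sum:
  assumes "c < r ^ n"
  shows "(r - 1) * (\<Sum>k=1..n. c div r ^ k) + digit_sum r n c = c"
  using assms
proof (induction n arbitrary: c)
  case (Suc n)
  define d where "d = c div r"
  have "r > 0" using Suc.prems by (cases r) auto
  then have "d < r ^ n"
    using Suc.prems unfolding d_def by (simp add: less_mult_imp_div_less mult.commute)
  then have IH: "(r - 1) * (\<Sum>k=1..n. d div r ^ k) + digit_sum r n d = d"
    by (rule Suc.IH)
  have "(\<Sum>k=1..Suc n. c div r ^ k) = d + (\<Sum>k=1..n. d div r ^ k)"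
    by (subst sum.atLeast_Suc_atMost)
      (simp_all add: sum.shift_bounds_cl_Suc_ivl div_mult2_eq d_def del: sum.cl_ivl_Suc)
  then have "(r - 1) * (\<Sum>k=1..Suc n. c div r ^ k) + digit_sum r (Suc n) c
      = (r - 1) * d + ((r - 1) * (\<Sum>k=1..n. d div r ^ k) + digit_sum r n d) + c mod r"
    by (simp add: d_def algebra_simps del: sum.cl_ivl_Suc)
  also have "\<dots> = r * d + c mod r"
    unfolding IH using \<open>r > 0\<close> by (cases r) simp_all
  also have "\<dots> = c" by (simp add: d_def)
  finally show ?case .
qed simp

lemma sum_digit_sum_Suc:
  assumes "r > 0"
  shows "(\<Sum>c<r ^ Suc n. f (digit_sum r (Suc n) c)) =
    (\<Sum>d<r. \<Sum>c<r ^ n. f (d + digit_sum r n c))"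
proof -
  have "(\<Sum>d<r. \<Sum>c<r ^ n. f (d + digit_sum r n c)) =
      (\<Sum>(d, c)\<in>{..<r} \<times> {..<r ^ n}. f (d + digit_sum r n c))"
    by (simp add: sum.cartesian_product)
  also have "\<dots> = (\<Sum>c<r ^ Suc n. f (digit_sum r (Suc n) c))"
  proof (rule sum.reindex_bij_witness[of _ "\<lambda>c. (c mod r, c div r)" "\<lambda>(d, c). d + r * c"])
    fix p assume "p \<in> {..<r} \<times> {..<r ^ n}"
    then obtain d c where p: "p = (d, c)" "d < r" "c < r ^ n" by auto
    have "r * Suc c \<le> r * r ^ n" using p(3) by (intro mult_le_mono2) simp
    with p(2) have "d + r * c < r * r ^ n" by simp
    with p show "(case p of (d, c) \<Rightarrow> d + r * c) \<in> {..<r ^ Suc n}" by simp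
  qed (use assms in \<open>auto simp: less_mult_imp_div_less mult.commute\<close>)
  finally show ?thesis by simp
qed

text \<open>With \<open>F(x) = (1 + x + \<dots> + x ^ m) ^ n\<close>, \<open>digit_section z m n k\<close> is the value at \<open>z\<close> of the
  section of \<open>x ^ k F(x)\<close> that collects the exponents divisible by \<open>m\<close>.\<close>

definition digit_section :: "'a::comm_semiring_1 \<Rightarrow> nat \<Rightarrow> nat \<Rightarrow> nat \<Rightarrow> 'a" where
  "digit_section z m n k = (\<Sum>c<Suc m ^ n.
     if m dvd digit_sum (Suc m) n c + k then z ^ ((digit_sum (Suc m) n c + k) div m) else 0)"

lemma digit_section_0: "digit_section z m 0 k = (if m dvd k then z ^ (k div m) else 0)"
  by (simp add: digit_section_def)

text \<open>The last digit \<open>d\<close> moves into the offset: multiplying \<open>F\<close> by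
  \<open>1 + x + ... + x ^ m\<close> becomes a window sum of sections.\<close>

lemma digit_section_Suc: "digit_section z m (Suc n) k = (\<Sum>d\<le>m. digit_section z m n (k + d))"
proof -
  have swap: "d + s + k = s + (k + d)" for d s by simp
  have "digit_section z m (Suc n) k = (\<Sum>d<Suc m. digit_section z m n (k + d))"
    unfolding digit_section_def
    by (subst sum_digit_sum_Suc[where f = "\<lambda>s. if m dvd s + k then z ^ ((s + k) div m) else 0"])
      (simp_all only: swap zero_less_Suc)
  then show ?thesis by (simp add: lessThan_Suc_atMost)
qed

lemma digit_section_add:
  "m > 0 \<Longrightarrow> digit_section z m n (k + m) = z * digit_section z m n k"
  unfolding digit_section_def sum_distrib_left
  by (intro sum.cong refl) (simp add: add.assoc[symmetric])

text \<open>For each \<open>c\<close> exactly one offset \<open>k < m\<close> completes the digit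
  sum to a multiple of \<open>m\<close>, with quotient \<open>cdiv\<close>.\<close>

lemma sum_digit_section:
  assumes "m > 0"
  shows "(\<Sum>k<m. digit_section z m n k) = (\<Sum>c<Suc m ^ n. z ^ cdiv (digit_sum (Suc m) n c) m)"
proof -
  have "(\<Sum>k<m. if m dvd s + k then z ^ ((s + k) div m) else 0) = z ^ cdiv s m" for s
  proof -
    have "(if m dvd s + k then z ^ ((s + k) div m) else 0) =
        (if k = m * cdiv s m - s then z ^ cdiv s m else 0)" if "k < m" for k
    proof (cases "m dvd s + k")
      case True
      then obtain j where j: "s + k = m * j" by blast
      with add_eq_mult_iff_cdiv[OF that] have "j = cdiv s m \<and> k = m * cdiv s m - s" by simp
      moreover from j have "(s + k) div m = j" using assms by simp
      ultimately show ?thesis using True by simp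
    next
      case False
      with add_eq_mult_iff_cdiv[OF that, of s "cdiv s m"] show ?thesis by auto
    qed
    then have "(\<Sum>k<m. if m dvd s + k then z ^ ((s + k) div m) else 0) =
        (\<Sum>k<m. if k = m * cdiv s m - s then z ^ cdiv s m else 0)"
      by (intro sum.cong) auto
    then show ?thesis using le_mult_cdiv(2)[OF assms, of s] by simp
  qed
  then show ?thesis
    unfolding digit_section_def by (subst sum.swap) simp
qed

section \<open>Unimodality of the sampled digit sum counts\<close>

text \<open>The centre is \<open>c / 2\<close>; doubled distances stay integral for odd
  \<open>c\<close>. Equal distances force equal values, so symmetry is included.\<close>

definition symmetric_decreasing :: "int \<Rightarrow> (int \<Rightarrow> int) \<Rightarrow> bool" where
  "symmetric_decreasing c a \<longleftrightarrow> (\<forall>i j. \<bar>2 * i - c\<bar> \<le> \<bar>2 * j - c\<bar> \<longrightarrow> a j \<le> a i)"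

text \<open>Successive window sums differ by \<open>a (s + 1) - a (s - int l)\<close>. Left of the
  new centre, \<open>s + 1\<close> is the index nearer to \<open>c / 2\<close>, so the sums do not
  decrease there; symmetry gives the other half.\<close>

lemma symmetric_decreasing_window:
  fixes a :: "int \<Rightarrow> int"
  assumes a: "symmetric_decreasing c a"
  shows "symmetric_decreasing (c + int l) (\<lambda>s. \<Sum>i\<le>l. a (s - int i))"
proof -
  define A c' where "A s = (\<Sum>i\<le>l. a (s - int i))" and "c' = c + int l" for s
  have a_sym: "a (c - s) = a s" for s
    using a unfolding symmetric_decreasing_def by (intro antisym) auto
  have A_sym: "A (c' - s) = A s" for s
  proof -
    have "A (c' - s) = (\<Sum>i\<le>l. a (c - (s - int (l - i))))"
      unfolding A_def c'_def by (intro sum.cong refl arg_cong[of _ _ a]) auto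
    also have "\<dots> = A s"
      unfolding A_def a_sym
      by (rule sum.reindex_bij_witness[of _ "\<lambda>i. l - i" "\<lambda>i. l - i"]) auto
    finally show ?thesis .
  qed
  have step: "A s \<le> A (s + 1)" if "2 * s + 1 \<le> c'" for s
  proof -
    have "A (s + 1) + a (s - int l) = A s + a (s + 1)"
      unfolding A_def by (subst (1) sum.atMost_shift)
        (simp add: lessThan_Suc_atMost[symmetric] algebra_simps)
    moreover have "a (s - int l) \<le> a (s + 1)"
      using a that unfolding symmetric_decreasing_def c'_def by auto
    ultimately show ?thesis by simp
  qed
  have mono: "A j \<le> A i" if "j \<le> i" "2 * i \<le> c'" for i j
    using that
  proof (induction rule: int_ge_induct)
    case (step i)
    then show ?case using \<open>\<And>s. 2 * s + 1 \<le> c' \<Longrightarrow> A s \<le> A (s + 1)\<close>[of i] by simp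
  qed simp
  have "A j \<le> A i" if "\<bar>2 * i - c'\<bar> \<le> \<bar>2 * j - c'\<bar>" for i j
  proof -
    define f where "f s = (if 2 * s \<le> c' then s else c' - s)" for s
    have "A (f j) \<le> A (f i)" using that by (intro mono) (auto simp: f_def split: if_splits)
    then show ?thesis by (simp add: f_def A_sym split: if_splits)
  qed
  then show ?thesis unfolding symmetric_decreasing_def A_def c'_def by blast
qed

lemma symmetric_decreasing_digit_sum:
  "symmetric_decreasing (int (m * n))
     (\<lambda>s. \<Sum>c<Suc m ^ n. if int (digit_sum (Suc m) n c) = s then 1 else 0)"
proof (induction n)
  case 0
  show ?case by (auto simp: symmetric_decreasing_def)
next
  case (Suc n)
  have "(\<Sum>c<Suc m ^ Suc n. if int (digit_sum (Suc m) (Suc n) c) = s then 1 else 0) =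
    (\<Sum>d\<le>m. \<Sum>c<Suc m ^ n. if int (digit_sum (Suc m) n c) = s - int d then 1 else (0::int))" for s
    by (subst sum_digit_sum_Suc[where f = "\<lambda>t. if int t = s then 1 else 0"])
      (simp_all add: algebra_simps lessThan_Suc_atMost)
  with symmetric_decreasing_window[OF Suc.IH, of m] show ?case
    by (simp add: algebra_simps)
qed

lemma unimodal_sum_monom_cdiv:
  assumes "m > 0"
  shows "unimodal (\<Sum>c<Suc m ^ n. monom 1 (cdiv (digit_sum (Suc m) n c) m))" (is "unimodal ?h")
proof -
  \<comment> \<open>The extra factor \<open>1 + ... + x ^ (m - 1)\<close> has only \<open>m\<close>
    terms, hence \<open>m - 1\<close> in both the centre and the window.\<close>
  define c where "c = int (m * n) + int (m - 1)"
  define a :: "int \<Rightarrow> int" where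
    "a s = (\<Sum>i\<le>m - 1. \<Sum>c<Suc m ^ n. if int (digit_sum (Suc m) n c) = s - int i then 1 else 0)" for s
  have a: "symmetric_decreasing c a"
    unfolding a_def c_def by (intro symmetric_decreasing_window symmetric_decreasing_digit_sum)
  have *: "(\<Sum>k\<le>m - 1. if int s = int (m * j) - int k then 1 else 0) =
      (if cdiv s m = j then 1 else (0::int))" for s j
  proof -
    have "(int s = int (m * j) - int k) \<longleftrightarrow> (k = m * cdiv s m - s \<and> cdiv s m = j)" if "k < m" for k
    proof -
      have "(int s = int (m * j) - int k) \<longleftrightarrow> s + k = m * j" by linarith
      with add_eq_mult_iff_cdiv[OF that, of s j] show ?thesis by auto
    qed
    then have "(\<Sum>k\<le>m - 1. if int s = int (m * j) - int k then 1 else 0) =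
        (\<Sum>k\<le>m - 1. if k = m * cdiv s m - s then if cdiv s m = j then 1 else 0 else (0::int))"
      using assms by (intro sum.cong) auto
    moreover have "m * cdiv s m - s \<le> m - 1" using le_mult_cdiv(2)[OF assms, of s] by linarith
    ultimately show ?thesis by simp
  qed
  have coeff: "coeff ?h j = a (int (m * j))" for j
    unfolding a_def by (subst sum.swap) (simp only: * coeff_sum coeff_monom)
  \<comment> \<open>The first \<open>j\<close> for which the midpoint of \<open>m * j\<close> and
    \<open>m * (j + 1)\<close> lies beyond the centre \<open>c / 2\<close>: earlier steps get no
    farther from the centre, later ones move away.\<close>
  define p where "p = (LEAST j. c < int (m * (2 * j + 1)))"
  have ex: "c < int (m * (2 * j + 1))" if "c \<le> int j" for j
  proof -
    have "1 * (2 * j + 1) \<le> m * (2 * j + 1)" using assms by (intro mult_le_mono1) simp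
    then have "int (2 * j + 1) \<le> int (m * (2 * j + 1))" by (simp only: of_nat_le_iff mult_1)
    moreover have "c < int (2 * j + 1)" using that by simp
    ultimately show ?thesis by (rule order.strict_trans2[rotated])
  qed
  have "c < int (m * (2 * p + 1))"
    unfolding p_def by (rule LeastI[of _ "nat c"], rule ex) simp
  moreover have "int (m * (2 * j + 1)) \<le> c" if "j < p" for j
    using not_less_Least that unfolding p_def by fastforce
  moreover have "m * (2 * p + 1) \<le> m * (2 * j + 1)" if "p \<le> j" for j
    using that by simp
  ultimately have desc: "c < int (m * (2 * j + 1))" if "p \<le> j" for j
    using that by (meson of_nat_le_iff order_less_le_trans)
  show ?thesis
    unfolding unimodal_def coeff
  proof (intro exI[of _ p] conjI allI impI)
    fix j assume "j < p"
    then have "int (m * (2 * j + 1)) \<le> c" by fact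
    then show "a (int (m * j)) \<le> a (int (m * (j + 1)))"
      using a assms unfolding symmetric_decreasing_def by (auto simp: algebra_simps)
  next
    fix j assume "p \<le> j"
    then have "c < int (m * (2 * j + 1))" by (rule desc)
    then show "a (int (m * (j + 1))) \<le> a (int (m * j))"
      using a assms unfolding symmetric_decreasing_def by (auto simp: algebra_simps)
  qed
qed

section \<open>Real-rootedness from the ordering of the sections\<close>

text \<open>For \<open>n = 0\<close> a section vanishes unless \<open>m\<close> divides its offset,
  so only \<open>j = 0\<close> and \<open>j = m\<close> can give two nonzero values. Each further
  digit is a window sum.\<close>

lemma digit_section_window_nonneg:
  assumes z: "Im z > 0" and "m > 0" "j \<le> m"
  shows "wedge (digit_section z m n k) (digit_section z m n (k + j)) \<ge> 0"
  using \<open>j \<le> m\<close>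
proof (induction n arbitrary: j k)
  case 0
  show ?case
  proof (cases "m dvd k \<and> m dvd k + j")
    case True
    then have "m dvd j" using dvd_add_right_iff[of m k j] by blast
    with 0 \<open>m > 0\<close> have "j = 0 \<or> j = m"
      using dvd_imp_le by fastforce
    then show ?thesis
      using z digit_section_add[OF \<open>m > 0\<close>, of z 0 k] by (auto simp: wedge_self wedge_mult_self)
  next
    case False
    then show ?thesis by (auto simp: digit_section_0 wedge_def)
  qed
next
  case (Suc n)
  show ?case
    unfolding digit_section_Suc
    by (rule wedge_window_sum_nonneg[OF z digit_section_add[OF \<open>m > 0\<close>] Suc.IH Suc.prems])
qed

lemma sum_power_cdiv_nonzero:
  fixes z :: complex
  assumes "Im z \<noteq> 0" "m > 0"
  shows "(\<Sum>c<Suc m ^ n. z ^ cdiv (digit_sum (Suc m) n c) m) \<noteq> 0"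
proof -
  have upper: "(\<Sum>c<Suc m ^ n. z ^ cdiv (digit_sum (Suc m) n c) m) \<noteq> 0" if z: "Im z > 0" for z
  proof -
    have per: "digit_section z m n m = z * digit_section z m n 0" for n
      using digit_section_add[OF \<open>m > 0\<close>, of z n 0] by simp
    note win = digit_section_window_nonneg[OF z \<open>m > 0\<close>]
    \<comment> \<open>The value is \<open>1\<close> for \<open>n = 0\<close> and afterwards itself a
      window sum of \<open>m + 1\<close> terms, so it stays nonzero.\<close>
    have nz: "digit_section z m n 0 \<noteq> 0" for n
    proof (induction n)
      case 0
      show ?case by (simp add: digit_section_0)
    next
      case (Suc n)
      show ?case
        using window_sum_nonzero[where G = "digit_section z m n" and l = "Suc m", OF z per win Suc.IH]
        by (simp add: digit_section_Suc lessThan_Suc_atMost)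
    qed
    show ?thesis
      using window_sum_nonzero[where G = "digit_section z m n" and l = m, OF z per win nz] \<open>m > 0\<close> by (simp add: sum_digit_section)
  qed
  show ?thesis
  proof (cases "Im z > 0")
    case False
    \<comment> \<open>The coefficients are real, so conjugation reduces the lower half-plane to the
      upper one.\<close>
    with assms have "Im (cnj z) > 0" by simp
    from upper[OF this] have "cnj (\<Sum>c<Suc m ^ n. z ^ cdiv (digit_sum (Suc m) n c) m) \<noteq> 0"
      by simp
    then show ?thesis by (simp only: complex_cnj_zero_iff not_False_eq_True)
  qed (rule upper)
qed

lemma real_rooted_sum_monom_cdiv:
  assumes "m > 0"
  shows "real_rooted (\<Sum>c<Suc m ^ n. monom 1 (cdiv (digit_sum (Suc m) n c) m))"
proof -
  define e where "e c = cdiv (digit_sum (Suc m) n c) m" for c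
  have "map_poly of_int (\<Sum>c<Suc m ^ n. monom 1 (e c)) = (\<Sum>c<Suc m ^ n. monom (1::complex) (e c))"
    by (intro poly_eqI) (simp add: coeff_map_poly coeff_sum if_distrib[of of_int] cong: if_cong)
  then have "poly (map_poly of_int (\<Sum>c<Suc m ^ n. monom 1 (e c))) z = (\<Sum>c<Suc m ^ n. z ^ e c)"
    for z :: complex
    by (simp add: poly_sum poly_monom)
  then show ?thesis
    unfolding real_rooted_def e_def[symmetric] complex_is_Real_iff
    using sum_power_cdiv_nonzero[OF _ assms, of _ n] by (auto simp: e_def)
qed

subsection \<open>Ehrhart series of weighted simplices\<close>

definition weighted_simplex :: "('n \<Rightarrow> nat) \<Rightarrow> (real ^ 'n::finite) set" where
  "weighted_simplex q = convex hull (insert (- (\<chi> i. real (q i))) (range (\<lambda>i. axis i 1)))"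

text \<open>The conditions are nonnegativity of barycentric coordinates: if \<open>x\<close> has
  weight \<open>b\<close> at \<open>- q\<close> and \<open>l_i\<close> at the unit vectors, then
  \<open>\<Sum> x_i = 1 - b N\<close>, so \<open>b = (1 - \<Sum> x_i) / N\<close> and
  \<open>l_i = x_i + b q_i\<close>.\<close>

lemma weighted_simplex_eq:
  fixes q :: "'n::finite \<Rightarrow> nat"
  defines "N \<equiv> Suc (sum q UNIV)"
  shows "weighted_simplex q =
    {x. (\<Sum>i\<in>UNIV. x $ i) \<le> 1 \<and> (\<forall>i. 0 \<le> x $ i + (1 - (\<Sum>i\<in>UNIV. x $ i)) * q i / N)}"
    (is "_ = ?H")
proof
  have "convex ?H"
  proof (rule convexI; clarsimp, intro conjI allI)
    fix x y :: "real ^ 'n" and u v :: real and i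
    define X Y where "X = (\<Sum>i\<in>UNIV. x $ i)" and "Y = (\<Sum>i\<in>UNIV. y $ i)"
    assume uv: "0 \<le> u" "0 \<le> v" "u + v = 1" and X: "sum (($) x) UNIV \<le> 1" and Y: "sum (($) y) UNIV \<le> 1"
      and x: "\<forall>i. 0 \<le> x $ i + (1 - sum (($) x) UNIV) * q i / N"
      and y: "\<forall>i. 0 \<le> y $ i + (1 - sum (($) y) UNIV) * q i / N"
    have sum: "(\<Sum>i\<in>UNIV. u * x $ i + v * y $ i) = u * X + v * Y"
      by (simp add: X_def Y_def sum.distrib sum_distrib_left)
    show "(\<Sum>i\<in>UNIV. u * x $ i + v * y $ i) \<le> 1"
      unfolding sum using convex_bound_le[of X 1 Y u v] X Y uv by (simp add: X_def Y_def)
    have "0 \<le> u * (x $ i + (1 - X) * q i / N) + v * (y $ i + (1 - Y) * q i / N)"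
      using uv x y by (simp add: X_def Y_def)
    also have "\<dots> = u * x $ i + v * y $ i + ((u + v) - (u * X + v * Y)) * q i / N"
      by (simp add: field_simps N_def del: of_nat_Suc)
    finally show "0 \<le> u * x $ i + v * y $ i + (1 - (\<Sum>i\<in>UNIV. u * x $ i + v * y $ i)) * q i / N"
      unfolding sum uv(3) .
  qed
  moreover have "- (\<chi> i. real (q i)) \<in> ?H"
    by (simp add: sum_negf N_def) (auto simp: field_simps add_nonneg_pos simp flip: of_nat_sum)
  moreover have "axis i 1 \<in> ?H" for i
    by (simp add: axis_def)
  ultimately show "weighted_simplex q \<subseteq> ?H"
    unfolding weighted_simplex_def by (intro hull_minimal) auto
next
  show "?H \<subseteq> weighted_simplex q"
  proof
    fix x assume "x \<in> ?H"
    define b where "b = (1 - (\<Sum>i\<in>UNIV. x $ i)) / N"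
    define l where "l = case_option b (\<lambda>i. x $ i + b * q i)"
    define v where "v = case_option (- (\<chi> i. real (q i))) (\<lambda>i. axis i (1::real))"
    have bN: "b * N = 1 - (\<Sum>i\<in>UNIV. x $ i)" by (simp add: b_def N_def del: of_nat_Suc)
    have "(\<Sum>k\<in>UNIV. l k *\<^sub>R v k) \<in> weighted_simplex q"
    proof (rule convex_sum)
      show "convex (weighted_simplex q)"
        unfolding weighted_simplex_def by (rule convex_convex_hull)
      have "sum l UNIV = b + (\<Sum>i\<in>UNIV. x $ i + b * q i)"
        by (simp add: UNIV_option_conv sum.reindex l_def o_def)
      also have "\<dots> = b * N + (\<Sum>i\<in>UNIV. x $ i)"
        by (simp add: N_def sum.distrib sum_distrib_left algebra_simps)
      finally show "sum l UNIV = 1" by (simp add: bN)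
      show "0 \<le> l k" for k
        using \<open>x \<in> ?H\<close> by (auto simp: l_def b_def split: option.splits)
      show "v k \<in> weighted_simplex q" for k
        unfolding weighted_simplex_def by (intro hull_inc) (auto simp: v_def split: option.splits)
    qed simp
    also have "(\<Sum>k\<in>UNIV. l k *\<^sub>R v k) = x"
      by (simp add: UNIV_option_conv sum.reindex l_def v_def o_def vec_eq_iff axis_def
          if_distrib[of "\<lambda>u. _ * u"] cong: if_cong)
    finally show "x \<in> weighted_simplex q" .
  qed
qed

lemma scaled_weighted_simplex_eq:
  fixes q :: "'n::finite \<Rightarrow> nat"
  defines "N \<equiv> Suc (sum q UNIV)"
  shows "(\<lambda>x. real t *\<^sub>R x) ` weighted_simplex q =
    {x. (\<Sum>i\<in>UNIV. x $ i) \<le> t \<and> (\<forall>i. 0 \<le> x $ i + (t - (\<Sum>i\<in>UNIV. x $ i)) * q i / N)}"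
    (is "_ = ?H")
proof (cases "t = 0")
  case True
  \<comment> \<open>Summing the inequalities gives \<open>X / N \<ge> 0\<close>, so
    \<open>X = 0\<close>, and nonnegative coordinates of sum 0 vanish.\<close>
  have "x = 0" if "x \<in> ?H" for x
  proof -
    define X where "X = (\<Sum>i\<in>UNIV. x $ i)"
    have X: "X \<le> 0" and x: "0 \<le> x $ i - X * q i / N" for i
      using that True by (auto simp: X_def)
    have "0 \<le> (\<Sum>i\<in>UNIV. x $ i - X * q i / N)" using x by (intro sum_nonneg) auto
    also have "\<dots> = X - X * (real N - 1) / N"
      by (simp add: sum_subtractf X_def N_def sum_distrib_left sum_divide_distrib)
    also have "X - X * (real N - 1) / N = X / N" by (simp add: diff_divide_distrib right_diff_distrib N_def del: of_nat_Suc)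
    finally have "X = 0" using X by (simp add: N_def zero_le_divide_iff del: of_nat_Suc)
    with x have nonneg: "0 \<le> x $ i" for i by auto
    with \<open>X = 0\<close> have "x $ i = 0" for i
      unfolding X_def by (subst (asm) sum_nonneg_eq_0_iff) auto
    then show ?thesis by (simp add: vec_eq_iff)
  qed
  moreover have "0 \<in> ?H" using True by simp
  ultimately have H: "?H = {0}" by (intro equalityI subsetI) (auto simp only: singleton_iff)
  have "axis undefined 1 \<in> weighted_simplex q"
    unfolding weighted_simplex_def by (intro hull_inc) simp
  then have "(\<lambda>x. real t *\<^sub>R x) ` weighted_simplex q = {0}"
    using True by auto
  then show ?thesis by (simp only: H)
next
  case False
  then have "(\<lambda>x. real t *\<^sub>R x) ` weighted_simplex q = {x. (1 / real t) *\<^sub>R x \<in> weighted_simplex q}"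
  proof (intro equalityI subsetI CollectI)
    fix x :: "real ^ 'n" assume "x \<in> {x. (1 / real t) *\<^sub>R x \<in> weighted_simplex q}"
    then show "x \<in> (\<lambda>x. real t *\<^sub>R x) ` weighted_simplex q"
      using False by (intro image_eqI[of _ _ "(1 / real t) *\<^sub>R x"]) simp_all
  qed (use False in auto)
  also have "\<dots> = ?H"
  proof (intro Collect_cong)
    fix x :: "real ^ 'n"
    define X where "X = (\<Sum>i\<in>UNIV. x $ i)"
    have sum: "(\<Sum>i\<in>UNIV. ((1 / real t) *\<^sub>R x) $ i) = X / t"
      unfolding X_def by (simp add: sum_divide_distrib)
    have coord: "((1 / real t) *\<^sub>R x) $ i + (1 - X / t) * q i / N = (x $ i + (t - X) * q i / N) / t" for i
      using False by (simp add: field_simps N_def del: of_nat_Suc)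
    have "(1 / real t) *\<^sub>R x \<in> weighted_simplex q \<longleftrightarrow>
        X / t \<le> 1 \<and> (\<forall>i. 0 \<le> (x $ i + (t - X) * q i / N) / t)"
      unfolding weighted_simplex_eq N_def[symmetric] mem_Collect_eq sum coord ..
    also have "\<dots> \<longleftrightarrow> X \<le> t \<and> (\<forall>i. 0 \<le> x $ i + (t - X) * q i / N)"
      using False by (simp only: divide_le_eq_1_pos zero_le_divide_iff of_nat_0_less_iff) auto
    finally show "(1 / real t) *\<^sub>R x \<in> weighted_simplex q \<longleftrightarrow>
        (\<Sum>i\<in>UNIV. x $ i) \<le> t \<and> (\<forall>i. 0 \<le> x $ i + (t - (\<Sum>i\<in>UNIV. x $ i)) * q i / N)"
      unfolding X_def .
  qed
  finally show ?thesis .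
qed

text \<open>Positive weights make the origin an interior point: its barycentric coordinates are
  \<open>1 / N\<close> and \<open>q i / N\<close>.\<close>

lemma aff_dim_weighted_simplex:
  fixes q :: "'n::finite \<Rightarrow> nat"
  assumes "\<And>i. q i > 0"
  shows "aff_dim (weighted_simplex q) = int CARD('n)"
proof -
  define U :: "(real ^ 'n) set" where
    "U = {x. (\<Sum>i\<in>UNIV. x $ i) < 1} \<inter>
      (\<Inter>i. {x. 0 < x $ i + (1 - (\<Sum>i\<in>UNIV. x $ i)) * q i / Suc (sum q UNIV)})"
  have "open U"
    unfolding U_def by (intro open_Int open_INT ballI open_Collect_less continuous_intros)
      (simp_all del: of_nat_Suc)
  moreover have "0 \<in> U" using assms by (simp add: U_def del: of_nat_Suc)
  moreover have "U \<subseteq> weighted_simplex q"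
    unfolding weighted_simplex_eq U_def by (auto intro: less_imp_le)
  ultimately have "0 \<in> interior (weighted_simplex q)" by (rule interiorI)
  then have "aff_dim (weighted_simplex q) = DIM(real ^ 'n)"
    by (intro aff_dim_nonempty_interior) auto
  then show ?thesis by simp
qed

section \<open>Heights of box points\<close>

text \<open>For \<open>b < N = Suc (sum q UNIV)\<close>, the box point with coefficient
  \<open>b / N\<close> at \<open>- q\<close> and the fractional part of \<open>q i * b / N\<close>
  at each unit vector has this height, since \<open>1 + \<Sum> q_i = N\<close>.\<close>

definition age :: "('n::finite \<Rightarrow> nat) \<Rightarrow> nat \<Rightarrow> nat" where
  "age q b = b - (\<Sum>i\<in>UNIV. q i * b div Suc (sum q UNIV))"

text \<open>The floors add up to at most \<open>b\<close>, so the truncated subtraction in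
  \<open>age\<close> is exact.\<close>

lemma age_add: "age q b + (\<Sum>i\<in>UNIV. q i * b div Suc (sum q UNIV)) = b"
proof -
  have "Suc (sum q UNIV) * (\<Sum>i\<in>UNIV. q i * b div Suc (sum q UNIV)) \<le> (\<Sum>i\<in>UNIV. q i * b)"
    unfolding sum_distrib_left by (intro sum_mono) (rule times_div_less_eq_dividend)
  also have "\<dots> \<le> Suc (sum q UNIV) * b" by (simp add: sum_distrib_right)
  finally show ?thesis unfolding age_def by (simp only: mult_le_cancel1) simp
qed

text \<open>Each floor falls short of \<open>q i * b / N\<close> by less than 1, so the age is at
  most \<open>b / N + CARD('n)\<close>. This bounds the degree of the candidate for
  \<open>h_star\<close>.\<close>

lemma age_le: "age (q :: 'n \<Rightarrow> nat) b \<le> CARD('n::finite)" if "b < Suc (sum q UNIV)"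
proof -
  define N where "N = Suc (sum q UNIV)"
  have "N * b = b + (\<Sum>i\<in>UNIV. q i * b)"
    by (simp add: N_def sum_distrib_right)
  also have "(\<Sum>i\<in>UNIV. q i * b) \<le> (\<Sum>i\<in>(UNIV::'n set). N * (q i * b div N) + N)"
  proof (intro sum_mono)
    fix i
    have "q i * b mod N < N" by (simp add: N_def)
    with mult_div_mod_eq[of N "q i * b"] show "q i * b \<le> N * (q i * b div N) + N" by linarith
  qed
  also have "\<dots> = N * ((\<Sum>i\<in>UNIV. q i * b div N) + CARD('n))"
    by (simp add: sum.distrib sum_distrib_left distrib_left)
  also have "b + \<dots> < N * ((\<Sum>i\<in>UNIV. q i * b div N) + CARD('n) + 1)"
    using that by (simp add: N_def)
  finally have "b < (\<Sum>i\<in>UNIV. q i * b div N) + CARD('n) + 1"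
    by (simp only: mult_less_cancel1)
  then show ?thesis by (simp add: age_def N_def)
qed

lemma age_add_mult:
  "age q (b + Suc (sum q UNIV) * l) = age q b + l"
proof -
  define N where "N = Suc (sum q UNIV)"
  have "q i * (b + N * l) div N = q i * b div N + q i * l" for i
  proof -
    have "q i * (b + N * l) = q i * b + N * (q i * l)" by (simp add: algebra_simps)
    moreover have "N \<noteq> 0" by (simp add: N_def)
    ultimately show ?thesis by (simp only: div_mult_self2 add.commute not_False_eq_True)
  qed
  then have "age q (b + N * l) + ((\<Sum>i\<in>UNIV. q i * b div N) + sum q UNIV * l) = b + N * l"
    using age_add[of q "b + N * l"] by (simp add: N_def sum.distrib sum_distrib_right)
  with age_add[of q b] show ?thesis by (simp add: N_def)
qed

section \<open>Generating function of compositions\<close>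

lemma finite_compositions:
  assumes "finite A"
  shows "finite {f :: 'a \<Rightarrow> nat. (\<forall>i. i \<notin> A \<longrightarrow> f i = 0) \<and> sum f A = k}"
proof (rule finite_subset)
  show "finite {f :: 'a \<Rightarrow> nat. \<forall>i. (i \<in> A \<longrightarrow> f i \<in> {..k}) \<and> (i \<notin> A \<longrightarrow> f i = 0)}"
    using assms by (intro finite_set_of_finite_funs) auto
  show "{f :: 'a \<Rightarrow> nat. (\<forall>i. i \<notin> A \<longrightarrow> f i = 0) \<and> sum f A = k}
      \<subseteq> {f. \<forall>i. (i \<in> A \<longrightarrow> f i \<in> {..k}) \<and> (i \<notin> A \<longrightarrow> f i = 0)}"
    using assms by (auto intro: member_le_sum)
qed

text \<open>A factor \<open>1 - fps_X\<close> removes one index \<open>a\<close>: functions of sum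
  \<open>k + 1\<close> either vanish at \<open>a\<close> or arise from those of sum \<open>k\<close>
  by raising the value at \<open>a\<close>.\<close>

lemma fps_compositions:
  assumes "finite A"
  shows "Abs_fps (\<lambda>k. int (card {f :: 'a \<Rightarrow> nat. (\<forall>i. i \<notin> A \<longrightarrow> f i = 0) \<and> sum f A = k}))
    * (1 - fps_X) ^ card A = 1"
  using assms
proof (induction A)
  case empty
  have "{f :: 'a \<Rightarrow> nat. \<forall>i. f i = 0} = {\<lambda>_. 0}"
    by auto
  then show ?case by (simp add: fps_eq_iff if_distrib[of card] if_distrib[of int] cong: if_cong)
next
  case (insert a A)
  define F where "F A k = {f :: 'a \<Rightarrow> nat. (\<forall>i. i \<notin> A \<longrightarrow> f i = 0) \<and> sum f A = k}" for A k
  have fin: "finite (F A k)" "finite (F (insert a A) k)" for k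
    unfolding F_def by (rule finite_compositions, simp add: insert.hyps)+
  have F0: "F (insert a A) 0 = F A 0"
    using insert.hyps by (auto simp: F_def) metis
  have FSuc: "F (insert a A) (Suc k) = F A (Suc k) \<union> (\<lambda>f. f(a := Suc (f a))) ` F (insert a A) k" for k
  proof (intro equalityI subsetI)
    fix f assume f: "f \<in> F (insert a A) (Suc k)"
    show "f \<in> F A (Suc k) \<union> (\<lambda>f. f(a := Suc (f a))) ` F (insert a A) k"
    proof (cases "f a")
      case 0
      with f insert.hyps have "f \<in> F A (Suc k)" by (auto simp: F_def) metis
      then show ?thesis by blast
    next
      case (Suc l)
      have "sum (f(a := l)) A = sum f A" using insert.hyps by (intro sum.cong) auto
      with f Suc insert.hyps have "f(a := l) \<in> F (insert a A) k" by (auto simp: F_def)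
      moreover have "f = (\<lambda>f. f(a := Suc (f a))) (f(a := l))" using Suc by auto
      ultimately show ?thesis by blast
    qed
  next
    fix f assume "f \<in> F A (Suc k) \<union> (\<lambda>f. f(a := Suc (f a))) ` F (insert a A) k"
    moreover have "sum (g(a := l)) A = sum g A" for g :: "'a \<Rightarrow> nat" and l
      using insert.hyps by (intro sum.cong) auto
    ultimately show "f \<in> F (insert a A) (Suc k)" using insert.hyps by (auto simp: F_def)
  qed
  have card_FSuc: "card (F (insert a A) (Suc k)) = card (F A (Suc k)) + card (F (insert a A) k)" for k
  proof -
    have "inj_on (\<lambda>f :: 'a \<Rightarrow> nat. f(a := Suc (f a))) S" for S
      by (rule inj_onI) (metis fun_upd_same fun_upd_triv fun_upd_upd nat.inject)
    moreover have "F A (Suc k) \<inter> (\<lambda>f. f(a := Suc (f a))) ` F (insert a A) k = {}"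
      using insert.hyps by (auto simp: F_def)
    ultimately show ?thesis
      unfolding FSuc using fin by (subst card_Un_disjoint) (auto simp: card_image)
  qed
  have "Abs_fps (\<lambda>k. int (card (F (insert a A) k))) * (1 - fps_X)
      = Abs_fps (\<lambda>k. int (card (F A k)))"
  proof (rule fps_ext)
    fix k
    show "fps_nth (Abs_fps (\<lambda>k. int (card (F (insert a A) k))) * (1 - fps_X)) k
        = fps_nth (Abs_fps (\<lambda>k. int (card (F A k)))) k"
      by (cases k) (simp_all add: right_diff_distrib F0 card_FSuc)
  qed
  then show ?case
    using insert.IH insert.hyps unfolding F_def by (simp add: mult.assoc[symmetric] del: sum.insert)
qed

section \<open>Lattice points and the numerator of the Ehrhart series\<close>

text \<open>A lattice point of the cone over the simplex is uniquely a box point plus a natural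
  combination \<open>f\<close> of the vertices. Here \<open>B = t - \<Sum> x_i\<close> splits as
  \<open>b + N * f None\<close>, and \<open>f (Some i)\<close> is the integer part of the coordinate
  \<open>x_i + q_i B / N\<close>; comparing heights gives the equation for \<open>f\<close>.\<close>

lemma lattice_count_weighted_simplex:
  fixes q :: "'n::finite \<Rightarrow> nat"
  shows "lattice_count (weighted_simplex q) t =
    (\<Sum>b<Suc (sum q UNIV). card {f :: 'n option \<Rightarrow> nat. sum f UNIV + age q b = t})"
proof -
  define N where "N = Suc (sum q UNIV)"
  define C where "C b = {f :: 'n option \<Rightarrow> nat. sum f UNIV + age q b = t}" for b
  define \<Phi> :: "nat \<times> ('n option \<Rightarrow> nat) \<Rightarrow> real ^ 'n" where
    "\<Phi> = (\<lambda>(b, f). \<chi> i. real (f (Some i)) - real (q i * (b + N * f None) div N))"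
  have sum_option: "sum f UNIV = f None + (\<Sum>i\<in>UNIV. f (Some i))" for f :: "'n option \<Rightarrow> nat"
    by (simp add: UNIV_option_conv sum.reindex o_def)
  have sum_\<Phi>: "(\<Sum>i\<in>UNIV. \<Phi> (b, f) $ i) = real t - real (b + N * f None)" if "f \<in> C b" for b f
  proof -
    have "f None + (\<Sum>i\<in>UNIV. f (Some i)) + age q b = t"
      using that by (simp add: C_def sum_option)
    then have "(\<Sum>i\<in>UNIV. f (Some i)) + (b + N * f None)
        = t + (\<Sum>i\<in>UNIV. q i * (b + N * f None) div N)"
      using age_add[of q "b + N * f None"] age_add_mult[of q b "f None"] by (simp add: N_def)
    then have "(\<Sum>i\<in>UNIV. real (f (Some i))) + real (b + N * f None)
        = real t + (\<Sum>i\<in>UNIV. real (q i * (b + N * f None) div N))"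
      by (simp only: of_nat_sum[symmetric] of_nat_add[symmetric])
    then show ?thesis by (simp add: \<Phi>_def sum_subtractf)
  qed
  have "bij_betw \<Phi> (SIGMA b:{..<N}. C b)
      ((\<lambda>x. real t *\<^sub>R x) ` weighted_simplex q \<inter> lattice_points)"
  proof (rule bij_betw_imageI)
    show "inj_on \<Phi> (SIGMA b:{..<N}. C b)"
    proof (rule inj_onI; clarify)
      fix b f b' f'
      assume bf: "b < N" "f \<in> C b" "b' < N" "f' \<in> C b'" and eq: "\<Phi> (b, f) = \<Phi> (b', f')"
      have "real t - real (b + N * f None) = real t - real (b' + N * f' None)"
        using sum_\<Phi>[OF bf(2)] sum_\<Phi>[OF bf(4)] unfolding eq by (rule trans[OF sym])
      then have "b + N * f None = b' + N * f' None"
        by linarith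
      moreover have "b = (b + N * f None) mod N" "f None = (b + N * f None) div N"
        "b' = (b' + N * f' None) mod N" "f' None = (b' + N * f' None) div N"
        using bf by simp_all
      ultimately have b: "b = b'" "f None = f' None" by metis+
      moreover have "f (Some i) = f' (Some i)" for i
        using arg_cong[OF eq, of "\<lambda>x. x $ i"] b by (simp add: \<Phi>_def)
      ultimately show "b = b' \<and> f = f'"
        by (auto simp: fun_eq_iff split_option_all)
    qed
    show "\<Phi> ` (SIGMA b:{..<N}. C b) = (\<lambda>x. real t *\<^sub>R x) ` weighted_simplex q \<inter> lattice_points"
      (is "_ = ?L")
    proof (intro equalityI subsetI)
      fix x assume "x \<in> \<Phi> ` (SIGMA b:{..<N}. C b)"
      then obtain b f where f: "f \<in> C b" and x: "x = \<Phi> (b, f)" by auto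
      define B where "B = b + N * f None"
      have tB: "real t - (\<Sum>i\<in>UNIV. x $ i) = real B" using sum_\<Phi>[OF f] by (simp add: x B_def)
      have "0 \<le> x $ i + B * q i / N" for i
      proof -
        have "real (q i * B div N) \<le> real (q i * B) / real N" by (rule of_nat_div_le_of_nat)
        then show ?thesis by (simp add: x \<Phi>_def B_def[symmetric] mult.commute)
      qed
      moreover have "(\<Sum>i\<in>UNIV. x $ i) \<le> t" using tB by linarith
      moreover have "x \<in> lattice_points" by (simp add: x \<Phi>_def lattice_points_def)
      ultimately show "x \<in> ?L"
        unfolding scaled_weighted_simplex_eq N_def[symmetric] using tB by simp
    next
      fix x assume "x \<in> ?L"
      then have xt: "(\<Sum>i\<in>UNIV. x $ i) \<le> t"
        and x0: "0 \<le> x $ i + (t - (\<Sum>i\<in>UNIV. x $ i)) * q i / N"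
        and xZ: "x $ i \<in> \<int>" for i
        unfolding scaled_weighted_simplex_eq N_def[symmetric] lattice_points_def by auto
      have "real t - (\<Sum>i\<in>UNIV. x $ i) \<in> \<int>" using xZ by auto
      then obtain B' where B': "real t - (\<Sum>i\<in>UNIV. x $ i) = of_int B'"
        by (rule Ints_cases)
      with xt have "B' \<ge> 0" by simp
      then obtain B where "B' = int B" using nonneg_int_cases by blast
      with B' have B: "real t - (\<Sum>i\<in>UNIV. x $ i) = real B" by simp
      have "\<exists>y. x $ i = real y - real (q i * B div N)" for i
      proof -
        obtain z where z: "x $ i = of_int z" using xZ by (auto elim: Ints_cases)
        have "- of_int z \<le> real (q i * B) / real N" using x0[of i] B z by (simp add: mult.commute)
        then have "- z \<le> \<lfloor>real (q i * B) / real N\<rfloor>" by (simp add: le_floor_iff)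
        then have "z + int (q i * B div N) \<ge> 0" by (simp add: floor_divide_of_nat_eq del: of_nat_mult)
        then obtain y where "z + int (q i * B div N) = int y" using nonneg_int_cases by blast
        then have "z = int y - int (q i * B div N)" by linarith
        with z show ?thesis by (intro exI[of _ y]) simp
      qed
      then obtain y where y: "\<And>i. x $ i = real (y i) - real (q i * B div N)" by metis
      define f where "f = case_option (B div N) y"
      have BN: "B mod N + N * f None = B" by (simp add: f_def)
      have "(\<Sum>i\<in>UNIV. real (y i)) + real B = real t + (\<Sum>i\<in>UNIV. real (q i * B div N))"
        using B by (simp add: y sum_subtractf)
      then have "(\<Sum>i\<in>UNIV. y i) + B = t + (\<Sum>i\<in>UNIV. q i * B div N)"
        by (simp only: of_nat_sum[symmetric] of_nat_add[symmetric] of_nat_eq_iff)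
      moreover have "age q B = age q (B mod N) + B div N"
        using age_add_mult[of q "B mod N" "B div N"] unfolding N_def[symmetric] mod_mult_div_eq .
      ultimately have "f \<in> C (B mod N)"
        using age_add[of q B] by (simp add: C_def sum_option f_def N_def)
      moreover have "x = \<Phi> (B mod N, f)"
        unfolding \<Phi>_def prod.case BN by (simp add: vec_eq_iff y f_def)
      moreover have "B mod N < N" by (simp add: N_def)
      ultimately show "x \<in> \<Phi> ` (SIGMA b:{..<N}. C b)" by auto
    qed
  qed
  then have "lattice_count (weighted_simplex q) t = card (SIGMA b:{..<N}. C b)"
    unfolding lattice_count_def by (simp add: bij_betw_same_card)
  also have "\<dots> = (\<Sum>b<N. card (C b))"
  proof (rule card_SigmaI)
    have "finite (C b)" for b
      by (rule finite_subset[OF _ finite_compositions[of UNIV "t - age q b"]]) (auto simp: C_def)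
    then show "\<forall>b\<in>{..<N}. finite (C b)" by blast
  qed simp
  finally show ?thesis unfolding C_def N_def .
qed

text \<open>The lattice count adds up compositions into \<open>CARD('n) + 1\<close> parts shifted by
  the ages, and these compositions have generating function
  \<open>1 / (1 - X) ^ (CARD('n) + 1)\<close>.\<close>

lemma h_star_weighted_simplex:
  fixes q :: "'n::finite \<Rightarrow> nat"
  assumes "\<And>i. q i > 0"
  shows "h_star (weighted_simplex q) = (\<Sum>b<Suc (sum q UNIV). monom 1 (age q b))"
proof (rule h_star_eqI)
  have dim: "nat (aff_dim (weighted_simplex q)) = CARD('n)"
    using assms by (simp add: aff_dim_weighted_simplex)
  show "degree (\<Sum>b<Suc (sum q UNIV). monom (1::int) (age q b)) \<le> nat (aff_dim (weighted_simplex q))"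
    unfolding dim using age_le[of _ q]
    by (intro degree_sum_le) (auto simp del: sum.lessThan_Suc intro!: order.trans[OF degree_monom_le])
  define Q where "Q = Abs_fps (\<lambda>k. int (card {f :: 'n option \<Rightarrow> nat. sum f UNIV = k}))"
  have Q: "Q * (1 - fps_X) ^ (CARD('n) + 1) = 1"
    using fps_compositions[of "UNIV :: 'n option set"] by (simp add: Q_def)
  have "ehrhart_series (weighted_simplex q) = (\<Sum>b<Suc (sum q UNIV). fps_X ^ age q b) * Q"
  proof (rule fps_ext)
    fix t
    have "int (card {f :: 'n option \<Rightarrow> nat. sum f UNIV + age q b = t}) = fps_nth (fps_X ^ age q b * Q) t" for b
    proof (cases "t < age q b")
      case False
      then have "sum f UNIV + age q b = t \<longleftrightarrow> sum f UNIV = t - age q b" for f :: "'n option \<Rightarrow> nat"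
        by linarith
      with False show ?thesis by (simp add: fps_X_power_mult_nth Q_def)
    qed (auto simp: fps_X_power_mult_nth)
    then show "fps_nth (ehrhart_series (weighted_simplex q)) t =
        fps_nth ((\<Sum>b<Suc (sum q UNIV). fps_X ^ age q b) * Q) t"
      by (simp add: ehrhart_series_def lattice_count_weighted_simplex sum_distrib_right
          fps_sum_nth del: sum.lessThan_Suc)
  qed
  then have "ehrhart_series (weighted_simplex q) * (1 - fps_X) ^ (CARD('n) + 1)
      = (\<Sum>b<Suc (sum q UNIV). fps_X ^ age q b)"
    using Q by (simp only: mult.assoc mult_1_right)
  then show "ehrhart_series (weighted_simplex q) * (1 - fps_X) ^ (nat (aff_dim (weighted_simplex q)) + 1)
      = fps_of_poly (\<Sum>b<Suc (sum q UNIV). monom 1 (age q b))"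
    unfolding dim by (simp add: fps_of_poly_sum fps_of_poly_monom' del: sum.lessThan_Suc)
qed

subsection \<open>The base-\<open>r\<close> simplex\<close>

lemma bij_betw_position:
  "bij_betw (\<lambda>i :: 'n :: {finite, linorder}. card {j. j < i}) UNIV {..<CARD('n)}"
proof -
  have mono: "card {j. j < i} < card {j. j < k}" if "i < k" for i k :: 'n
    using that by (intro psubset_card_mono) auto
  have inj: "inj (\<lambda>i :: 'n. card {j. j < i})"
    by (rule injI) (metis mono linorder_less_linear less_irrefl)
  moreover have "(\<lambda>i :: 'n. card {j. j < i}) ` UNIV = {..<CARD('n)}"
  proof (rule card_subset_eq)
    have "card {j. j < i} < CARD('n)" for i :: 'n
      by (intro psubset_card_mono) auto
    then show "(\<lambda>i :: 'n. card {j. j < i}) ` UNIV \<subseteq> {..<CARD('n)}" by auto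
  qed (use inj in \<open>simp_all add: card_image\<close>)
  ultimately show ?thesis by (simp add: bij_betw_def)
qed

definition base_weight :: "nat \<Rightarrow> 'n :: {finite, linorder} \<Rightarrow> nat" where
  "base_weight m i = m * Suc m ^ card {j. j < i}"

lemma base_simplex_eq_weighted: "base_simplex (Suc m) = weighted_simplex (base_weight m)"
  by (simp add: base_simplex_def weighted_simplex_def base_q_def base_weight_def)

lemma sum_base_weight:
  "Suc (sum (base_weight m :: 'n :: {finite, linorder} \<Rightarrow> nat) UNIV) = Suc m ^ CARD('n)"
proof -
  have "sum (base_weight m) (UNIV :: 'n set) = (\<Sum>p<CARD('n). m * Suc m ^ p)"
    unfolding base_weight_def
    by (rule sum.reindex_bij_betw[OF bij_betw_position])
  moreover have "Suc (\<Sum>p<n. m * Suc m ^ p) = Suc m ^ n" for n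
    by (induction n) simp_all
  ultimately show ?thesis by simp
qed

text \<open>Write \<open>m * b = N * v + c\<close>. The floors sum to
  \<open>v * (N - 1) / m + \<Sum> c div r ^ k\<close>, so after multiplication by \<open>m\<close>
  Legendre's formula leaves \<open>m * age = digit_sum r n c + v\<close>. As \<open>b < N\<close>
  forces \<open>v < m\<close>, the age is the ceiling.\<close>

lemma age_base_weight:
  fixes b m :: nat
  defines "n \<equiv> CARD('n :: {finite, linorder})"
  assumes "m > 0" "b < Suc m ^ n"
  shows "age (base_weight m :: 'n \<Rightarrow> nat) b = cdiv (digit_sum (Suc m) n (m * b mod Suc m ^ n)) m"
proof -
  define r N where "r = Suc m" and "N = r ^ n"
  define c v where "c = m * b mod N" and "v = m * b div N"
  have "N > 0" by (simp add: N_def r_def)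
  then have "c < r ^ n" by (simp add: c_def N_def)
  have "(\<Sum>i\<in>UNIV. base_weight m (i :: 'n) * b div N) = (\<Sum>p<n. (m * r ^ p) * b div N)"
    unfolding base_weight_def r_def n_def by (rule sum.reindex_bij_betw[OF bij_betw_position])
  also have "\<dots> = (\<Sum>p<n. v * r ^ p + c div r ^ (n - p))"
  proof (intro sum.cong refl)
    fix p assume "p \<in> {..<n}"
    then have N: "N = r ^ p * r ^ (n - p)" by (simp add: N_def flip: power_add)
    have "(m * r ^ p) * b div N = (r ^ p * (m * b)) div (r ^ p * r ^ (n - p))"
      by (simp add: N ac_simps)
    also have "\<dots> = (m * b) div r ^ (n - p)" by (simp add: r_def del: power_Suc)
    also have "m * b = c + r ^ (n - p) * (v * r ^ p)"
      using mult_div_mod_eq[of N "m * b"] by (simp add: c_def v_def N ac_simps)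
    also have "\<dots> div r ^ (n - p) = v * r ^ p + c div r ^ (n - p)"
      by (rule div_mult_self2) (simp add: r_def)
    finally show "(m * r ^ p) * b div N = v * r ^ p + c div r ^ (n - p)" .
  qed
  also have "\<dots> = v * (\<Sum>p<n. r ^ p) + (\<Sum>k=1..n. c div r ^ k)"
  proof -
    have "(\<Sum>p<n. c div r ^ (n - p)) = (\<Sum>k=1..n. c div r ^ k)"
      by (rule sum.reindex_bij_witness[of _ "\<lambda>k. n - k" "\<lambda>p. n - p"]) auto
    then show ?thesis by (simp add: sum.distrib sum_distrib_left)
  qed
  finally have b: "age (base_weight m :: 'n \<Rightarrow> nat) b + (v * (\<Sum>p<n. r ^ p) + (\<Sum>k=1..n. c div r ^ k)) = b"
    using age_add[of "base_weight m :: 'n \<Rightarrow> nat" b]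
    unfolding sum_base_weight n_def[symmetric] r_def[symmetric] N_def[symmetric] by simp
  have "m * age (base_weight m :: 'n \<Rightarrow> nat) b + v * (m * (\<Sum>p<n. r ^ p)) + m * (\<Sum>k=1..n. c div r ^ k)
      = m * b"
    using arg_cong[OF b, of "\<lambda>x. m * x"] by (simp only: distrib_left add.assoc mult.left_commute)
  also have "m * b = N * v + c"
    unfolding c_def v_def mult_div_mod_eq ..
  finally have "m * age (base_weight m :: 'n \<Rightarrow> nat) b + v * (m * (\<Sum>p<n. r ^ p)) + m * (\<Sum>k=1..n. c div r ^ k)
      = N * v + c" .
  moreover have "Suc (m * (\<Sum>p<n. r ^ p)) = N"
    unfolding N_def r_def by (induction n) (simp_all add: algebra_simps)
  then have "N * v = v + v * (m * (\<Sum>p<n. r ^ p))" by (metis mult.commute mult_Suc_right)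
  moreover have "m * (\<Sum>k=1..n. c div r ^ k) + digit_sum r n c = c"
    using legendre_digit_sum[OF \<open>c < r ^ n\<close>] by (simp add: r_def)
  ultimately have "digit_sum r n c + v = m * age (base_weight m :: 'n \<Rightarrow> nat) b"
    by linarith
  moreover have "v < m"
    using assms by (simp add: v_def N_def r_def less_mult_imp_div_less)
  ultimately show ?thesis
    unfolding c_def N_def r_def by (simp add: add_eq_mult_iff_cdiv)
qed

lemma bij_betw_mult_mod:
  fixes m N :: nat
  assumes "coprime m N" "N > 0"
  shows "bij_betw (\<lambda>b. m * b mod N) {..<N} {..<N}"
proof -
  have *: "b' = b" if "b \<le> b'" "b' < N" "m * b mod N = m * b' mod N" for b b'
  proof -
    have "N dvd m * b' - m * b"
      using that by (subst mod_eq_dvd_iff_nat[symmetric]) auto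
    then have "N dvd m * (b' - b)" by (simp add: diff_mult_distrib2)
    then have "N dvd b' - b"
      using assms by (simp add: coprime_dvd_mult_right_iff coprime_commute)
    moreover have "b' - b < N" using that(2) by simp
    ultimately have "\<not> 0 < b' - b" using nat_dvd_not_less by blast
    with that(1) show ?thesis by simp
  qed
  have "inj_on (\<lambda>b. m * b mod N) {..<N}"
  proof (rule inj_onI)
    fix b b' assume "b \<in> {..<N}" "b' \<in> {..<N}" and eq: "m * b mod N = m * b' mod N"
    then have "b < N" "b' < N" by simp_all
    then show "b = b'"
      using *[OF _ _ eq] *[OF _ _ eq[symmetric]] nat_le_linear[of b b'] by blast
  qed
  moreover from this have "(\<lambda>b. m * b mod N) ` {..<N} = {..<N}"
    using assms by (intro endo_inj_surj) auto
  ultimately show ?thesis by (simp add: bij_betw_def)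
qed

text \<open>As \<open>Suc m\<close> is coprime to \<open>m\<close>, the residue
  \<open>c = m * b mod N\<close> runs through all numbers below \<open>N\<close> when
  \<open>b\<close> does.\<close>

lemma h_star_base_simplex:
  fixes m :: nat
  assumes "m > 0"
  shows "h_star (base_simplex (Suc m) :: (real ^ ('n :: {finite, linorder})) set) =
    (\<Sum>c<Suc m ^ CARD('n). monom 1 (cdiv (digit_sum (Suc m) CARD('n) c) m))" (is "h_star ?P = _")
proof -
  define n where "n = CARD('n)"
  have "h_star ?P
      = (\<Sum>b<Suc m ^ n. monom 1 (age (base_weight m :: 'n \<Rightarrow> nat) b))"
    unfolding base_simplex_eq_weighted
    using assms by (subst h_star_weighted_simplex) (simp_all add: base_weight_def sum_base_weight[unfolded base_weight_def] n_def)
  also have "\<dots> = (\<Sum>b<Suc m ^ n. monom 1 (cdiv (digit_sum (Suc m) n (m * b mod Suc m ^ n)) m))"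
    using assms by (intro sum.cong refl) (simp add: age_base_weight n_def)
  also have "\<dots> = (\<Sum>c<Suc m ^ n. monom 1 (cdiv (digit_sum (Suc m) n c) m))"
    by (rule sum.reindex_bij_betw[OF bij_betw_mult_mod]) simp_all
  finally show ?thesis by (simp add: n_def)
qed

theorem theorem4p5:
  fixes r :: nat
  assumes "r \<ge> 2"
  shows "real_rooted (h_star (base_simplex r :: (real ^ ('n :: {finite, linorder})) set)) \<and>
         unimodal (h_star (base_simplex r :: (real ^ ('n :: {finite, linorder})) set))"
proof -
  obtain m where r: "r = Suc m" and "m > 0"
    using assms by (cases r) auto
  then show ?thesis
    unfolding r h_star_base_simplex[OF \<open>m > 0\<close>]
    by (intro conjI real_rooted_sum_monom_cdiv unimodal_sum_monom_cdiv)
qed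

end
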